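(* Let $X$ be a (nonempty) $T_{3.5}$ space, and let $\mathbf 0\in C_p(X)$ be the constant zero function. The following are equivalent. (a) $X$ is countable. (b) Player II has a winning Markov strategy in $G_1(\mathcal O_X,\mathcal O_X)$. (c) Player II has a winning Markov strategy in $G_1(\Omega_X,\Omega_X)$. (d) Player I has a winning predetermined strategy in $PO(X)$. (e) Player I has a winning predetermined strategy in $FO(X)$. (f) Player I has a winning predetermined strategy in $\Omega FO(X)$. (g) $C_p(X)$ is first-countable. (h) Player I has a winning predetermined strategy in Gruenhage's $W$-game on $C_p(X)$ at $\mathbf 0$. (i) Player I has a winning predetermined strategy in Gruenhage's clustering game on $C_p(X)$ at $\mathbf 0$. (j) Player I has a winning predetermined strategy in $CL(C_p(X),\mathbf 0)$. (k) Player I has a winning predetermined strategy in $CD(C_p(X))$. (l) Player II has a winning Markov strategy in $G_1(\Omega_{C_p(X),\mathbf 0},\Omega_{C_p(X),\mathbf 0})$. (m) Player II has a winning Markov strategy in $G_1(\mathcal D_{C_p(X)},\Omega_{C_p(X),\mathbf 0})$.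
   Context: Spaces are nonempty. "Countable" includes finite. $C_p(X)$ is the space of continuous functions $X\to\mathbb R$ with the topology of pointwise convergence; $T_{3.5}$ means completely regular and $T_1$. $\omega=\{0,1,2,\dots\}$. Collections. $\mathcal O_X$ is the collection of open covers of $X$. An $\omega$-cover of $X$ is an open cover $\mathcal U$ such that every finite $F\subseteq X$ is contained in some $U\in\mathcal U$; $\Omega_X$ is the collection of $\omega$-covers of $X$. For a space $Y$ and $y\in Y$, $\Omega_{Y,y}$ is the collection of $A\subseteq Y$ with $y\in\overline A$, and $\mathcal D_Y$ is the collection of dense subsets of $Y$. Games (all of length $\omega$; in round $n$ player I moves first, then player II). - $G_1(\mathcal A,\mathcal B)$: I chooses $A_n\in\mathcal A$, then II chooses $b_n\in A_n$; II wins if $\{b_n:n<\omega\}\in\mathcal B$, otherwise I wins. - $PO(X)$ (point-open game): I plays a point $x_n\in X$, II plays an open set $U_n\ni x_n$. I wins if $X=\bigcup_n U_n$; otherwise II wins. - $FO(X)$ (finite-open game): I plays a finite set $F_n\subseteq X$, II plays an open set $U_n\supseteq F_n$. I wins if $X=\bigcup_n U_n$; otherwise II wins. - $\Omega FO(X)$: same moves as $FO(X)$, but I wins if $\{U_n:n<\omega\}$ is an $\omega$-cover of $X$; otherwise II wins. - Gruenhage's $W$-game on $Y$ at $y$: I plays an open set $U_n\ni y$, II plays a point $y_n\in U_n$. I wins if $y_n\to y$; otherwise II wins. - Gruenhage's clustering game on $Y$ at $y$: same moves as the $W$-game, but I wins if $y$ is a cluster point of the sequence $(y_n)_{n<\omega}$,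 i.e. every neighborhood of $y$ contains $y_n$ for infinitely many $n$; otherwise II wins. - $CL(Y,y)$: I plays a nonempty open set $U_n\subseteq Y$, II plays a point $y_n\in U_n$. I wins if $y\in\overline{\{y_n:n<\omega\}}$; otherwise II wins. - $CD(Y)$: same moves as $CL(Y,y)$, but II wins if $\{y_n:n<\omega\}$ is closed and discrete in $Y$; otherwise I wins. Strategies. A Markov strategy for II is a function $\sigma$ giving II's move from only the most recent move of I and the round number. A predetermined strategy for I is a function giving I's move from only the round number. A strategy is winning if the player using it wins against every legal sequence of moves of the opponent. *)

theory Defs
  imports "HOL-Analysis.Analysis"
begin

text \<open>Points of the function space are real functions on the carrier of \<open>X\<close>, encoded, as in
  \<^const>\<open>product_topology\<close>, by functions that are \<^term>\<open>undefined\<close> outside the carrier.\<close>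

definition Cp :: "'a topology \<Rightarrow> ('a \<Rightarrow> real) topology" where
  "Cp X = subtopology (product_topology (\<lambda>_. euclideanreal) (topspace X))
            {f. continuous_map X euclideanreal f}"

definition Cp_zero :: "'a topology \<Rightarrow> 'a \<Rightarrow> real" where
  "Cp_zero X = (\<lambda>x\<in>topspace X. 0)"

definition open_covers :: "'a topology \<Rightarrow> 'a set set set" where
  "open_covers X = {\<U>. (\<forall>U\<in>\<U>. openin X U) \<and> \<Union>\<U> = topspace X}"

text \<open>The whole space is allowed as a member of an \<open>\<omega>\<close>-cover.\<close>

definition omega_covers :: "'a topology \<Rightarrow> 'a set set set" where
  "omega_covers X =
     {\<U> \<in> open_covers X. \<forall>F. finite F \<and> F \<subseteq> topspace X \<longrightarrow> (\<exists>U\<in>\<U>. F \<subseteq> U)}"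

definition clustering_sets :: "'a topology \<Rightarrow> 'a \<Rightarrow> 'a set set" where
  "clustering_sets Y y = {A. A \<subseteq> topspace Y \<and> y \<in> Y closure_of A}"

definition dense_sets :: "'a topology \<Rightarrow> 'a set set" where
  "dense_sets Y = {D. D \<subseteq> topspace Y \<and> Y closure_of D = topspace Y}"

definition closed_discrete :: "'a topology \<Rightarrow> 'a set \<Rightarrow> bool" where
  "closed_discrete Y S \<longleftrightarrow> closedin Y S \<and> subtopology Y S = discrete_topology S"

definition cluster_point :: "'a topology \<Rightarrow> (nat \<Rightarrow> 'a) \<Rightarrow> 'a \<Rightarrow> bool" where
  "cluster_point Y s y \<longleftrightarrow>
     y \<in> topspace Y \<and> (\<forall>U. openin Y U \<and> y \<in> U \<longrightarrow> infinite {n. s n \<in> U})"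

text \<open>In every round player I makes a move from a fixed set, and player II answers with a reply
  whose legality depends only on that move. The winner depends only on the sequence of
  replies: I wins if it satisfies \<open>I_wins\<close>, and otherwise II wins.\<close>

record ('m, 'r) game =
  moves :: "'m set"
  replies :: "'m \<Rightarrow> 'r set"
  I_wins :: "(nat \<Rightarrow> 'r) \<Rightarrow> bool"

definition predetermined_winning_I :: "('m, 'r) game \<Rightarrow> (nat \<Rightarrow> 'm) \<Rightarrow> bool" where
  "predetermined_winning_I G s \<longleftrightarrow>
     (\<forall>n. s n \<in> moves G) \<and>
     (\<forall>r. (\<forall>n. r n \<in> replies G (s n)) \<longrightarrow> I_wins G r)"

definition Markov_winning_II :: "('m, 'r) game \<Rightarrow> ('m \<Rightarrow> nat \<Rightarrow> 'r) \<Rightarrow> bool" where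
  "Markov_winning_II G \<sigma> \<longleftrightarrow>
     (\<forall>m\<in>moves G. \<forall>n. \<sigma> m n \<in> replies G m) \<and>
     (\<forall>p. (\<forall>n. p n \<in> moves G) \<longrightarrow> \<not> I_wins G (\<lambda>n. \<sigma> (p n) n))"

definition I_has_winning_predetermined :: "('m, 'r) game \<Rightarrow> bool" where
  "I_has_winning_predetermined G \<longleftrightarrow> (\<exists>s. predetermined_winning_I G s)"

definition II_has_winning_Markov :: "('m, 'r) game \<Rightarrow> bool" where
  "II_has_winning_Markov G \<longleftrightarrow> (\<exists>\<sigma>. Markov_winning_II G \<sigma>)"

definition G1 :: "'b set set \<Rightarrow> 'b set set \<Rightarrow> ('b set, 'b) game" where
  "G1 \<A> \<B> = \<lparr>moves = \<A>, replies = (\<lambda>A. A), I_wins = (\<lambda>b. range b \<notin> \<B>)\<rparr>"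

definition PO :: "'a topology \<Rightarrow> ('a, 'a set) game" where
  "PO X = \<lparr>moves = topspace X,
           replies = (\<lambda>x. {U. openin X U \<and> x \<in> U}),
           I_wins = (\<lambda>U. topspace X = (\<Union>n. U n))\<rparr>"

definition FO :: "'a topology \<Rightarrow> ('a set, 'a set) game" where
  "FO X = \<lparr>moves = {F. finite F \<and> F \<subseteq> topspace X},
           replies = (\<lambda>F. {U. openin X U \<and> F \<subseteq> U}),
           I_wins = (\<lambda>U. topspace X = (\<Union>n. U n))\<rparr>"

definition OmegaFO :: "'a topology \<Rightarrow> ('a set, 'a set) game" where
  "OmegaFO X = \<lparr>moves = {F. finite F \<and> F \<subseteq> topspace X},
                replies = (\<lambda>F. {U. openin X U \<and> F \<subseteq> U}),
                I_wins = (\<lambda>U. range U \<in> omega_covers X)\<rparr>"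

definition Gruenhage_W :: "'a topology \<Rightarrow> 'a \<Rightarrow> ('a set, 'a) game" where
  "Gruenhage_W Y y = \<lparr>moves = {U. openin Y U \<and> y \<in> U},
                      replies = (\<lambda>U. U),
                      I_wins = (\<lambda>s. limitin Y s y sequentially)\<rparr>"

definition Gruenhage_clustering :: "'a topology \<Rightarrow> 'a \<Rightarrow> ('a set, 'a) game" where
  "Gruenhage_clustering Y y = \<lparr>moves = {U. openin Y U \<and> y \<in> U},
                               replies = (\<lambda>U. U),
                               I_wins = (\<lambda>s. cluster_point Y s y)\<rparr>"

definition CL :: "'a topology \<Rightarrow> 'a \<Rightarrow> ('a set, 'a) game" where
  "CL Y y = \<lparr>moves = {U. openin Y U \<and> U \<noteq> {}},
             replies = (\<lambda>U. U),
             I_wins = (\<lambda>s. y \<in> Y closure_of (range s))\<rparr>"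

definition CD :: "'a topology \<Rightarrow> ('a set, 'a) game" where
  "CD Y = \<lparr>moves = {U. openin Y U \<and> U \<noteq> {}},
           replies = (\<lambda>U. U),
           I_wins = (\<lambda>s. \<not> closed_discrete Y (range s))\<rparr>"

end

theory Submission
  imports Defs
begin

text \<open>
  A predetermined strategy of I is a sequence of moves, and II can answer each move legally by
  attending to finitely many points of \<open>X\<close>: in \<open>PO\<close>, \<open>FO\<close> and \<open>\<Omega>FO\<close> by definition, and in the games
  on \<open>C\<^sub>p(X)\<close> because membership in a basic open set depends on finitely many values. So the whole
  strategy controls only countably many points. If \<open>X\<close> is uncountable, some point \<open>y\<close> is left free,
  and II wins by misbehaving there: by always playing \<open>X - {y}\<close> in the covering games, and by playing
  functions \<open>f\<^sub>n\<close> with \<open>f\<^sub>n(y) = n + 1\<close> in the games on \<open>C\<^sub>p(X)\<close> (lemma \<open>Cp_pick_unbounded\<close>; this is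
  where complete regularity enters). Such a sequence is closed and discrete and stays away from
  \<open>\<zero>\<close>, so it defeats I in all of those games at once. If \<open>X\<close> is countable, I can run through all of
  its points, or all of its finite subsets, and \<open>C\<^sub>p(X)\<close> lies in a countable power of the line, hence
  is first countable; shrinking neighbourhoods of \<open>\<zero>\<close> then win every game on \<open>C\<^sub>p(X)\<close>.

  Markov strategies of II in the selection games are handled by duality with these games of I.
  If every way of answering all moves of a game \<open>G\<close> at once has an image in \<open>\<A>\<close>, then in each round
  a Markov strategy for \<open>G\<^sub>1(\<A>, \<B>)\<close> must realise \<^emph>\<open>all\<close> replies to some move of \<open>G\<close>; playing these
  moves is a predetermined strategy of I (\<open>predetermined_if_Markov\<close>). Conversely, if each member of
  \<open>\<A>\<close> contains a legal reply to each move of \<open>G\<close>, II can use such replies against a fixed sequence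
  of moves (\<open>Markov_if_predetermined\<close>). The equivalence is then assembled from the cycle
  (a), (g), (h), (i), (j), (a), the detours (h), (k), (a) and (i), (l), (m), (j), and the covering
  games, which are linked through \<open>PO\<close> and \<open>\<Omega>FO\<close>.
\<close>

section \<open>Duality between selection games and games of player I\<close>

text \<open>If the conclusion failed in some round \<open>n\<close>, every move \<open>m\<close> would have a reply \<open>f m\<close> that
  \<open>\<sigma>\<close> never selects in that round. But the set of all these \<open>f m\<close> is itself a move, from which
  \<open>\<sigma>\<close> has to select.\<close>

lemma Markov_realises_all_replies:
  assumes \<sigma>: "Markov_winning_II (G1 \<A> \<B>) \<sigma>"
    and choice: "\<And>f. (\<And>m. m \<in> moves G \<Longrightarrow> f m \<in> replies G m) \<Longrightarrow> f ` moves G \<in> \<A>"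
  shows "\<exists>m\<in>moves G. replies G m \<subseteq> (\<lambda>A. \<sigma> A n) ` \<A>"
proof (rule ccontr)
  assume "\<not> ?thesis"
  then have "\<forall>m. \<exists>r. m \<in> moves G \<longrightarrow> r \<in> replies G m \<and> r \<notin> (\<lambda>A. \<sigma> A n) ` \<A>"
    by blast
  then obtain f where f: "\<And>m. m \<in> moves G \<Longrightarrow> f m \<in> replies G m \<and> f m \<notin> (\<lambda>A. \<sigma> A n) ` \<A>"
    by metis
  have "f ` moves G \<in> \<A>"
    using f by (intro choice) blast
  moreover from this have "\<sigma> (f ` moves G) n \<in> f ` moves G"
    using \<sigma> by (simp add: Markov_winning_II_def G1_def)
  ultimately obtain m where "m \<in> moves G" "\<sigma> (f ` moves G) n = f m"
    by blast
  with \<open>f ` moves G \<in> \<A>\<close> show False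
    using f by (metis imageI)
qed

lemma predetermined_if_Markov:
  assumes "II_has_winning_Markov (G1 \<A> \<B>)"
    and "\<And>f. (\<And>m. m \<in> moves G \<Longrightarrow> f m \<in> replies G m) \<Longrightarrow> f ` moves G \<in> \<A>"
    and "\<And>r. range r \<in> \<B> \<Longrightarrow> I_wins G r"
  shows "I_has_winning_predetermined G"
proof -
  obtain \<sigma> where \<sigma>: "Markov_winning_II (G1 \<A> \<B>) \<sigma>"
    using assms(1) by (auto simp: II_has_winning_Markov_def)
  then have "\<exists>m\<in>moves G. replies G m \<subseteq> (\<lambda>A. \<sigma> A n) ` \<A>" for n
    using assms(2) by (rule Markov_realises_all_replies)
  then obtain s where s: "\<And>n. s n \<in> moves G" "\<And>n. replies G (s n) \<subseteq> (\<lambda>A. \<sigma> A n) ` \<A>"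
    by metis
  have "I_wins G r" if r: "\<forall>n. r n \<in> replies G (s n)" for r
  proof -
    have "\<forall>n. \<exists>A. A \<in> \<A> \<and> r n = \<sigma> A n"
      using s(2) r by blast
    then obtain p where p: "\<And>n. p n \<in> \<A>" "\<And>n. r n = \<sigma> (p n) n"
      by metis
    then have "range (\<lambda>n. \<sigma> (p n) n) \<in> \<B>"
      using \<sigma> by (simp add: Markov_winning_II_def G1_def)
    moreover have "r = (\<lambda>n. \<sigma> (p n) n)"
      using p(2) by blast
    ultimately show ?thesis
      using assms(3) by blast
  qed
  then show ?thesis
    using s(1) by (auto simp: I_has_winning_predetermined_def predetermined_winning_I_def)
qed

lemma Markov_if_predetermined:
  assumes "I_has_winning_predetermined G"
    and meets: "\<And>A m. A \<in> \<A> \<Longrightarrow> m \<in> moves G \<Longrightarrow> A \<inter> replies G m \<noteq> {}"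
    and wins: "\<And>s r. (\<And>n. s n \<in> moves G) \<Longrightarrow> (\<And>n. r n \<in> replies G (s n)) \<Longrightarrow> I_wins G r
                 \<Longrightarrow> range r \<in> \<B>"
  shows "II_has_winning_Markov (G1 \<A> \<B>)"
proof -
  obtain s where s: "\<And>n. s n \<in> moves G"
    "\<And>r. \<forall>n. r n \<in> replies G (s n) \<Longrightarrow> I_wins G r"
    using assms(1) by (auto simp: I_has_winning_predetermined_def predetermined_winning_I_def)
  define \<sigma> where "\<sigma> A n = (SOME b. b \<in> A \<inter> replies G (s n))" for A n
  have \<sigma>: "\<sigma> A n \<in> A \<inter> replies G (s n)" if "A \<in> \<A>" for A n
    unfolding \<sigma>_def using meets[OF that s(1)] by (metis some_in_eq)
  have "range (\<lambda>n. \<sigma> (p n) n) \<in> \<B>" if p: "\<forall>n. p n \<in> \<A>" for p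
  proof (rule wins)
    show "\<sigma> (p n) n \<in> replies G (s n)" for n
      using \<sigma> p by blast
    then show "I_wins G (\<lambda>n. \<sigma> (p n) n)"
      using s(2)[of "\<lambda>n. \<sigma> (p n) n"] by blast
  qed (rule s(1))
  then have "Markov_winning_II (G1 \<A> \<B>) \<sigma>"
    using \<sigma> by (auto simp: Markov_winning_II_def G1_def)
  then show ?thesis
    by (auto simp: II_has_winning_Markov_def)
qed

text \<open>I carries a winning strategy for \<open>G\<close> over to \<open>H\<close>, translating each move by \<open>t\<close> into one that
  leaves II only replies that were already allowed in \<open>G\<close>.\<close>

lemma predetermined_transfer:
  assumes "I_has_winning_predetermined G"
    and "\<And>m. m \<in> moves G \<Longrightarrow> t m \<in> moves H \<and> replies H (t m) \<subseteq> replies G m"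
    and "\<And>s r. (\<And>n. s n \<in> moves G) \<Longrightarrow> (\<And>n. r n \<in> replies H (t (s n))) \<Longrightarrow> I_wins G r
           \<Longrightarrow> I_wins H r"
  shows "I_has_winning_predetermined H"
proof -
  obtain s where s: "\<And>n. s n \<in> moves G"
    "\<And>r. \<forall>n. r n \<in> replies G (s n) \<Longrightarrow> I_wins G r"
    using assms(1) by (auto simp: I_has_winning_predetermined_def predetermined_winning_I_def)
  have "predetermined_winning_I H (\<lambda>n. t (s n))"
    unfolding predetermined_winning_I_def
  proof (intro conjI allI impI)
    show "t (s n) \<in> moves H" for n
      using assms(2) s(1) by blast
    show "I_wins H r" if r: "\<forall>n. r n \<in> replies H (t (s n))" for r
    proof (rule assms(3))
      show "I_wins G r"
        using assms(2) s r by blast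
    qed (use s r in auto)
  qed
  then show ?thesis
    by (auto simp: I_has_winning_predetermined_def)
qed

section \<open>Covering games\<close>

lemma PO_if_countable:
  assumes "topspace X \<noteq> {}" "countable (topspace X)"
  shows "I_has_winning_predetermined (PO X)"
proof -
  obtain s :: "nat \<Rightarrow> 'a" where s: "range s = topspace X"
    using assms by (metis range_from_nat_into)
  have "topspace X = (\<Union>n. U n)" if U: "\<forall>n. openin X (U n) \<and> s n \<in> U n" for U
  proof
    show "topspace X \<subseteq> (\<Union>n. U n)"
      unfolding s[symmetric] using U by blast
    show "(\<Union>n. U n) \<subseteq> topspace X"
      using U openin_subset by blast
  qed
  then have "predetermined_winning_I (PO X) s"
    using s by (auto simp: predetermined_winning_I_def PO_def)
  then show ?thesis
    by (auto simp: I_has_winning_predetermined_def)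
qed

lemma FO_if_PO:
  assumes "I_has_winning_predetermined (PO X)"
  shows "I_has_winning_predetermined (FO X)"
  by (rule predetermined_transfer[OF assms, where t = "\<lambda>x. {x}"]) (auto simp: PO_def FO_def)

lemma OmegaFO_if_countable:
  assumes "countable (topspace X)"
  shows "I_has_winning_predetermined (OmegaFO X)"
proof -
  let ?\<F> = "{F. finite F \<and> F \<subseteq> topspace X}"
  have "countable ?\<F>" "?\<F> \<noteq> {}"
    using assms countable_Collect_finite_subset by auto
  then obtain s :: "nat \<Rightarrow> 'a set" where s: "range s = ?\<F>"
    by (metis range_from_nat_into)
  have "range U \<in> omega_covers X" if U: "\<forall>n. openin X (U n) \<and> s n \<subseteq> U n" for U
  proof -
    have ex: "\<exists>n. F \<subseteq> U n" if "finite F" "F \<subseteq> topspace X" for F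
    proof -
      have "F \<in> range s"
        using that s by simp
      then show ?thesis
        using U by blast
    qed
    have "\<exists>n. x \<in> U n" if "x \<in> topspace X" for x
      using ex[of "{x}"] that by auto
    moreover have "U n \<subseteq> topspace X" for n
      using U openin_subset by blast
    ultimately have "topspace X = (\<Union>n. U n)"
      by blast
    then show ?thesis
      using U ex by (auto simp: omega_covers_def open_covers_def)
  qed
  moreover have "\<forall>n. s n \<in> ?\<F>"
    using s by blast
  ultimately have "predetermined_winning_I (OmegaFO X) s"
    by (simp add: predetermined_winning_I_def OmegaFO_def)
  then show ?thesis
    by (auto simp: I_has_winning_predetermined_def)
qed

lemma FO_if_OmegaFO:
  assumes "I_has_winning_predetermined (OmegaFO X)"
  shows "I_has_winning_predetermined (FO X)"
  by (rule predetermined_transfer[OF assms, where t = "\<lambda>F. F"])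
     (auto simp: OmegaFO_def FO_def omega_covers_def open_covers_def)

text \<open>Against finite sets \<open>s n\<close> whose union misses a point \<open>y\<close>, II always plays the complement of
  \<open>y\<close>, which is open in a \<open>T\<^sub>1\<close> space.\<close>

lemma countable_if_FO:
  assumes "t1_space X" "I_has_winning_predetermined (FO X)"
  shows "countable (topspace X)"
proof -
  obtain s where "predetermined_winning_I (FO X) s"
    using assms(2) by (auto simp: I_has_winning_predetermined_def)
  then have s: "\<And>n. finite (s n)" "\<And>n. s n \<subseteq> topspace X"
    "\<And>U. \<forall>n. openin X (U n) \<and> s n \<subseteq> U n \<Longrightarrow> topspace X = (\<Union>n. U n)"
    by (simp_all add: predetermined_winning_I_def FO_def)
  have "topspace X \<subseteq> (\<Union>n. s n)"
  proof
    fix y assume y: "y \<in> topspace X"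
    show "y \<in> (\<Union>n. s n)"
    proof (rule ccontr)
      assume "y \<notin> (\<Union>n. s n)"
      moreover have "openin X (topspace X - {y})"
        using assms(1) y by (simp add: t1_space_closedin_singleton openin_diff)
      ultimately have "topspace X = (\<Union>n::nat. topspace X - {y})"
        using s(2) by (intro s(3)) blast
      then show False
        using y by blast
    qed
  qed
  then show ?thesis
    using s(1) by (meson countable_UN countable_finite countable_subset countableI_type)
qed

lemma Markov_open_covers_iff_PO:
  "II_has_winning_Markov (G1 (open_covers X) (open_covers X)) \<longleftrightarrow>
   I_has_winning_predetermined (PO X)"
proof
  assume "II_has_winning_Markov (G1 (open_covers X) (open_covers X))"
  then show "I_has_winning_predetermined (PO X)"
  proof (rule predetermined_if_Markov)
    fix f :: "'a \<Rightarrow> 'a set"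
    assume "\<And>x. x \<in> moves (PO X) \<Longrightarrow> f x \<in> replies (PO X) x"
    then have f: "\<And>x. x \<in> topspace X \<Longrightarrow> openin X (f x) \<and> x \<in> f x"
      by (simp add: PO_def)
    moreover from this have "f x \<subseteq> topspace X" if "x \<in> topspace X" for x
      using that openin_subset by blast
    ultimately have "\<Union>(f ` topspace X) = topspace X"
      by blast
    then show "f ` moves (PO X) \<in> open_covers X"
      using f by (auto simp: open_covers_def PO_def)
  next
    show "I_wins (PO X) r" if "range r \<in> open_covers X" for r
      using that by (simp add: PO_def open_covers_def)
  qed
next
  assume "I_has_winning_predetermined (PO X)"
  then show "II_has_winning_Markov (G1 (open_covers X) (open_covers X))"
  proof (rule Markov_if_predetermined)
    show "\<U> \<inter> replies (PO X) x \<noteq> {}" if "\<U> \<in> open_covers X" "x \<in> moves (PO X)" for \<U> x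
      using that by (auto simp: PO_def open_covers_def)
  qed (auto simp: PO_def open_covers_def)
qed

lemma Markov_omega_covers_iff_OmegaFO:
  "II_has_winning_Markov (G1 (omega_covers X) (omega_covers X)) \<longleftrightarrow>
   I_has_winning_predetermined (OmegaFO X)"
proof
  assume "II_has_winning_Markov (G1 (omega_covers X) (omega_covers X))"
  then show "I_has_winning_predetermined (OmegaFO X)"
  proof (rule predetermined_if_Markov)
    fix f :: "'a set \<Rightarrow> 'a set"
    assume "\<And>F. F \<in> moves (OmegaFO X) \<Longrightarrow> f F \<in> replies (OmegaFO X) F"
    then have f: "\<And>F. finite F \<Longrightarrow> F \<subseteq> topspace X \<Longrightarrow> openin X (f F) \<and> F \<subseteq> f F"
      by (simp add: OmegaFO_def)
    have "x \<in> \<Union>(f ` {F. finite F \<and> F \<subseteq> topspace X})" if "x \<in> topspace X" for x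
    proof (rule UN_I)
      show "{x} \<in> {F. finite F \<and> F \<subseteq> topspace X}"
        using that by simp
      show "x \<in> f {x}"
        using f[of "{x}"] that by simp
    qed
    moreover have "f F \<subseteq> topspace X" if "finite F" "F \<subseteq> topspace X" for F
      using f[OF that] openin_subset by blast
    ultimately have "\<Union>(f ` {F. finite F \<and> F \<subseteq> topspace X}) = topspace X"
      by (intro subset_antisym subsetI) auto
    moreover have "\<exists>U\<in>f ` {F. finite F \<and> F \<subseteq> topspace X}. F \<subseteq> U"
      if "finite F" "F \<subseteq> topspace X" for F
      using f[OF that] that by (intro bexI[of _ "f F"]) simp_all
    ultimately show "f ` moves (OmegaFO X) \<in> omega_covers X"
      using f by (simp add: omega_covers_def open_covers_def OmegaFO_def)
  qed (simp add: OmegaFO_def)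
next
  assume "I_has_winning_predetermined (OmegaFO X)"
  then show "II_has_winning_Markov (G1 (omega_covers X) (omega_covers X))"
  proof (rule Markov_if_predetermined)
    show "\<U> \<inter> replies (OmegaFO X) F \<noteq> {}"
      if "\<U> \<in> omega_covers X" "F \<in> moves (OmegaFO X)" for \<U> F
    proof -
      have "\<exists>U\<in>\<U>. F \<subseteq> U" "\<forall>U\<in>\<U>. openin X U"
        using that by (simp_all add: OmegaFO_def omega_covers_def open_covers_def)
      then show ?thesis
        by (auto simp: OmegaFO_def)
    qed
  qed (simp add: OmegaFO_def)
qed

section \<open>Convergence and clustering games on a space\<close>

lemma Gruenhage_W_if_first_countable:
  assumes "first_countable Y" "y \<in> topspace Y"
  shows "I_has_winning_predetermined (Gruenhage_W Y y)"
proof -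
  obtain B where B: "countable B" "\<And>V. V \<in> B \<Longrightarrow> openin Y V"
    "\<And>U. openin Y U \<Longrightarrow> y \<in> U \<Longrightarrow> \<exists>V\<in>B. y \<in> V \<and> V \<subseteq> U"
    using assms unfolding first_countable_def by meson
  define C where "C = {V\<in>B. y \<in> V}"
  have "countable C" "C \<noteq> {}"
    using B(1) B(3)[OF openin_topspace assms(2)] by (auto simp: C_def)
  then obtain b :: "nat \<Rightarrow> 'a set" where b: "range b = C"
    by (metis range_from_nat_into)
  have b_nbhd: "openin Y (b n)" "y \<in> b n" for n
    using b B(2) by (auto simp: C_def)
  \<comment> \<open>Finite intersections make the base decreasing, so that the replies stay in each member
    once they have entered it.\<close>
  define s where "s n = (\<Inter>i\<le>n. b i)" for n
  have "limitin Y r y sequentially" if r: "\<forall>n. r n \<in> s n" for r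
    unfolding limitin_def
  proof (intro conjI allI impI)
    fix U assume U: "openin Y U \<and> y \<in> U"
    then obtain V where "V \<in> C" "V \<subseteq> U"
      using B(3) by (auto simp: C_def)
    then obtain k where "b k \<subseteq> U"
      using b by blast
    then have "r n \<in> U" if "n \<ge> k" for n
      using r that by (auto simp: s_def)
    then show "\<forall>\<^sub>F n in sequentially. r n \<in> U"
      by (auto simp: eventually_sequentially)
  qed (rule assms(2))
  moreover have "\<forall>n. openin Y (s n) \<and> y \<in> s n"
    using b_nbhd by (auto simp: s_def)
  ultimately have "predetermined_winning_I (Gruenhage_W Y y) s"
    by (simp add: predetermined_winning_I_def Gruenhage_W_def)
  then show ?thesis
    by (auto simp: I_has_winning_predetermined_def)
qed

lemma cluster_point_if_limitin:
  assumes "limitin Y s y sequentially"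
  shows "cluster_point Y s y"
  unfolding cluster_point_def
proof (intro conjI allI impI)
  show "y \<in> topspace Y"
    using assms by (simp add: limitin_def)
  fix U assume "openin Y U \<and> y \<in> U"
  then obtain N where N: "\<And>n. n \<ge> N \<Longrightarrow> s n \<in> U"
    using assms by (auto simp: limitin_def eventually_sequentially)
  show "infinite {n. s n \<in> U}"
    using N infinite_super[of "{N..}" "{n. s n \<in> U}"] by (auto simp: infinite_Ici)
qed

lemma in_closure_of_range_if_cluster_point:
  assumes "cluster_point Y s y"
  shows "y \<in> Y closure_of range s"
proof -
  have "\<exists>n. s n \<in> U" if "openin Y U" "y \<in> U" for U
    using assms that not_finite_existsD unfolding cluster_point_def by metis
  then show ?thesis
    using assms by (auto simp: in_closure_of cluster_point_def)
qed

lemma Gruenhage_clustering_if_W: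
  assumes "I_has_winning_predetermined (Gruenhage_W Y y)"
  shows "I_has_winning_predetermined (Gruenhage_clustering Y y)"
  by (rule predetermined_transfer[OF assms, where t = "\<lambda>U. U"])
     (auto simp: Gruenhage_W_def Gruenhage_clustering_def intro: cluster_point_if_limitin)

lemma CL_if_Gruenhage_clustering:
  assumes "I_has_winning_predetermined (Gruenhage_clustering Y y)"
  shows "I_has_winning_predetermined (CL Y y)"
  by (rule predetermined_transfer[OF assms, where t = "\<lambda>U. U"])
     (auto simp: Gruenhage_clustering_def CL_def intro: in_closure_of_range_if_cluster_point)

text \<open>A sequence converging to \<open>y\<close> may have a closed discrete range only if it takes the value \<open>y\<close>.
  So I removes \<open>y\<close> from the neighbourhoods; they stay nonempty because \<open>y\<close> is not isolated.\<close>

lemma CD_if_Gruenhage_W: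
  assumes "I_has_winning_predetermined (Gruenhage_W Y y)"
    and "t1_space Y" and "\<not> openin Y {y}"
  shows "I_has_winning_predetermined (CD Y)"
proof (rule predetermined_transfer[OF assms(1), where t = "\<lambda>U. U - {y}"])
  fix U assume "U \<in> moves (Gruenhage_W Y y)"
  then have U: "openin Y U" "y \<in> U"
    by (auto simp: Gruenhage_W_def)
  then have "openin Y (U - {y})"
    using assms(2) openin_subset by (fastforce simp: t1_space_closedin_singleton intro: openin_diff)
  moreover have "U - {y} \<noteq> {}"
    using U assms(3) by (metis Diff_eq_empty_iff empty_iff subset_singletonD)
  ultimately show "U - {y} \<in> moves (CD Y) \<and>
      replies (CD Y) (U - {y}) \<subseteq> replies (Gruenhage_W Y y) U"
    by (auto simp: CD_def Gruenhage_W_def)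
next
  fix s and r :: "nat \<Rightarrow> 'a"
  assume "\<And>n. r n \<in> replies (CD Y) (s n - {y})"
  then have ne: "\<And>n. r n \<noteq> y"
    by (simp add: CD_def)
  assume "I_wins (Gruenhage_W Y y) r"
  then have "y \<in> Y closure_of range r"
    by (simp add: Gruenhage_W_def cluster_point_if_limitin in_closure_of_range_if_cluster_point)
  then have "\<not> closedin Y (range r)"
    using ne by (force simp: closure_of_closedin)
  then show "I_wins (CD Y) r"
    by (simp add: CD_def closed_discrete_def)
qed

lemma Markov_clustering_if_Gruenhage_clustering:
  assumes "I_has_winning_predetermined (Gruenhage_clustering Y y)"
  shows "II_has_winning_Markov (G1 (clustering_sets Y y) (clustering_sets Y y))"
  using assms
proof (rule Markov_if_predetermined)
  show "A \<inter> replies (Gruenhage_clustering Y y) U \<noteq> {}"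
    if "A \<in> clustering_sets Y y" "U \<in> moves (Gruenhage_clustering Y y)" for A U
    using that by (auto simp: clustering_sets_def in_closure_of Gruenhage_clustering_def)
next
  fix s and r :: "nat \<Rightarrow> 'a"
  assume "\<And>n. s n \<in> moves (Gruenhage_clustering Y y)"
    and "\<And>n. r n \<in> replies (Gruenhage_clustering Y y) (s n)"
  then have "range r \<subseteq> topspace Y"
    using openin_subset[of Y] by (fastforce simp: Gruenhage_clustering_def)
  moreover assume "I_wins (Gruenhage_clustering Y y) r"
  ultimately show "range r \<in> clustering_sets Y y"
    by (simp add: clustering_sets_def Gruenhage_clustering_def in_closure_of_range_if_cluster_point)
qed

lemma Markov_dense_if_Markov_clustering:
  assumes "II_has_winning_Markov (G1 (clustering_sets Y y) \<B>)" "y \<in> topspace Y"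
  shows "II_has_winning_Markov (G1 (dense_sets Y) \<B>)"
proof -
  have dense: "D \<in> clustering_sets Y y" if "D \<in> dense_sets Y" for D
    using that assms(2) by (auto simp: dense_sets_def clustering_sets_def)
  obtain \<sigma> where "Markov_winning_II (G1 (clustering_sets Y y) \<B>) \<sigma>"
    using assms(1) by (auto simp: II_has_winning_Markov_def)
  then have "Markov_winning_II (G1 (dense_sets Y) \<B>) \<sigma>"
    by (simp add: Markov_winning_II_def G1_def dense)
  then show ?thesis
    by (auto simp: II_has_winning_Markov_def)
qed

lemma CL_if_Markov_dense:
  assumes "II_has_winning_Markov (G1 (dense_sets Y) (clustering_sets Y y))"
  shows "I_has_winning_predetermined (CL Y y)"
  using assms
proof (rule predetermined_if_Markov)
  fix f :: "'a set \<Rightarrow> 'a"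
  assume "\<And>U. U \<in> moves (CL Y y) \<Longrightarrow> f U \<in> replies (CL Y y) U"
  then have f: "\<And>U. openin Y U \<Longrightarrow> U \<noteq> {} \<Longrightarrow> f U \<in> U"
    by (simp add: CL_def)
  then have "f ` {U. openin Y U \<and> U \<noteq> {}} \<subseteq> topspace Y"
    using openin_subset[of Y] by blast
  moreover have "Y closure_of (f ` {U. openin Y U \<and> U \<noteq> {}}) = topspace Y"
    unfolding dense_intersects_open
  proof (intro allI impI)
    fix U assume "openin Y U \<and> U \<noteq> {}"
    then have "f U \<in> f ` {U. openin Y U \<and> U \<noteq> {}} \<inter> U"
      using f by simp
    then show "f ` {U. openin Y U \<and> U \<noteq> {}} \<inter> U \<noteq> {}"
      by blast
  qed
  ultimately show "f ` moves (CL Y y) \<in> dense_sets Y"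
    by (simp add: dense_sets_def CL_def)
qed (simp add: CL_def clustering_sets_def)

text \<open>A neighbourhood on which \<open>g\<close> varies by less than \<open>1\<close> contains at most one term of the sequence,
  and that term can be removed as points are closed. So there are no accumulation points.\<close>

lemma closed_discrete_if_unbounded_values:
  fixes s :: "nat \<Rightarrow> 'a" and g :: "'a \<Rightarrow> real"
  assumes "t1_space Y" and g: "continuous_map Y euclideanreal g"
    and s: "range s \<subseteq> topspace Y" and gs: "\<And>n. g (s n) = real n + c"
  shows "closed_discrete Y (range s)"
proof -
  have "x \<notin> Y derived_set_of range s" for x
  proof
    assume "x \<in> Y derived_set_of range s"
    then have x: "x \<in> topspace Y"
      and acc: "\<And>T. x \<in> T \<Longrightarrow> openin Y T \<Longrightarrow> \<exists>n. s n \<noteq> x \<and> s n \<in> T"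
      by (auto simp: in_derived_set_of)
    define T where "T = {z \<in> topspace Y. g z \<in> ball (g x) (1/2)}"
    have T: "openin Y T" "x \<in> T"
      unfolding T_def using x by (auto intro!: openin_continuous_map_preimage[OF g] simp del: mem_ball)
    then obtain n where n: "s n \<noteq> x" "s n \<in> T"
      using acc by blast
    have "openin Y (T - {s n})"
      using assms(1) T s by (auto simp: t1_space_closedin_singleton intro!: openin_diff)
    then obtain m where m: "s m \<in> T" "s m \<noteq> s n"
      using acc[of "T - {s n}"] T n by auto
    have "\<bar>g x - (real n + c)\<bar> < 1/2" "\<bar>g x - (real m + c)\<bar> < 1/2"
      using n(2) m(1) by (auto simp: T_def dist_real_def gs)
    then have "\<bar>real m - real n\<bar> < 1"
      by linarith
    then have "m = n"
      by linarith
    then show False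
      using m by simp
  qed
  then have "Y derived_set_of range s = {}"
    by blast
  then show ?thesis
    using s by (simp add: closed_discrete_def closedin_contains_derived_set
        subtopology_eq_discrete_topology_eq)
qed

section \<open>The space of continuous functions\<close>

lemma topspace_Cp:
  "topspace (Cp X) = {f \<in> extensional (topspace X). continuous_map X euclideanreal f}"
  by (auto simp: Cp_def PiE_def)

lemma Cp_zero_in_topspace: "Cp_zero X \<in> topspace (Cp X)"
proof -
  have "continuous_map X euclideanreal (Cp_zero X)"
    by (rule continuous_map_eq[of _ _ "\<lambda>_. 0"]) (auto simp: Cp_zero_def)
  then show ?thesis
    by (auto simp: topspace_Cp Cp_zero_def)
qed

lemma t1_space_Cp: "t1_space (Cp X)"
  unfolding Cp_def
  by (intro Hausdorff_imp_t1_space Hausdorff_space_subtopology)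
     (simp add: Hausdorff_space_product_topology)

lemma continuous_map_Cp_eval:
  assumes "x \<in> topspace X"
  shows "continuous_map (Cp X) euclideanreal (\<lambda>f. f x)"
  unfolding Cp_def
  by (intro continuous_map_from_subtopology continuous_map_product_projection assms)

lemma first_countable_Cp_if_countable:
  assumes "countable (topspace X)"
  shows "first_countable (Cp X)"
proof -
  have "metrizable_space (product_topology (\<lambda>_. euclideanreal) (topspace X))"
    using assms
    by (auto simp: metrizable_space_product_topology metrizable_space_euclidean
        intro: countable_subset)
  then show ?thesis
    unfolding Cp_def by (intro metrizable_imp_first_countable metrizable_space_subtopology)
qed

text \<open>The line of constant functions passes through \<open>\<zero>\<close>, continuously and injectively since \<open>X\<close> is
  nonempty.\<close>

lemma Cp_zero_not_isolated:
  assumes "topspace X \<noteq> {}"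
  shows "\<not> openin (Cp X) {Cp_zero X}"
proof
  let ?const = "\<lambda>t::real. \<lambda>x\<in>topspace X. t"
  have "continuous_map X euclideanreal (?const t)" for t
    by (rule continuous_map_eq[of _ _ "\<lambda>_. t"]) auto
  then have "continuous_map euclideanreal (Cp X) ?const"
    unfolding Cp_def by (auto simp: continuous_map_in_subtopology continuous_map_componentwise)
  moreover assume "openin (Cp X) {Cp_zero X}"
  ultimately have "openin euclideanreal {t \<in> topspace euclideanreal. ?const t \<in> {Cp_zero X}}"
    by (rule openin_continuous_map_preimage)
  moreover have "{t \<in> topspace euclideanreal. ?const t \<in> {Cp_zero X}} = {0}"
  proof -
    obtain x where "x \<in> topspace X"
      using assms by blast
    then have "t = 0" if "?const t = Cp_zero X" for t
      using fun_cong[OF that, of x] by (simp add: Cp_zero_def)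
    then show ?thesis
      by (auto simp: Cp_zero_def)
  qed
  ultimately show False
    by (simp add: not_open_singleton)
qed

lemma Cp_open_finite_support:
  assumes "openin (Cp X) U" "g \<in> U"
  obtains F where "finite F" "F \<subseteq> topspace X"
    "\<And>h. h \<in> topspace (Cp X) \<Longrightarrow> (\<And>x. x \<in> F \<Longrightarrow> h x = g x) \<Longrightarrow> h \<in> U"
proof -
  obtain W where W: "openin (product_topology (\<lambda>_. euclideanreal) (topspace X)) W"
    and U: "U = W \<inter> {f. continuous_map X euclideanreal f}"
    using assms(1) by (auto simp: Cp_def openin_subtopology)
  then obtain V where V: "finite {x \<in> topspace X. V x \<noteq> (UNIV :: real set)}"
    "g \<in> Pi\<^sub>E (topspace X) V" "Pi\<^sub>E (topspace X) V \<subseteq> W"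
    using assms(2) by (force simp: openin_product_topology_alt)
  show thesis
  proof (rule that[OF V(1)])
    fix h assume h: "h \<in> topspace (Cp X)"
      and eq: "\<And>x. x \<in> {x \<in> topspace X. V x \<noteq> UNIV} \<Longrightarrow> h x = g x"
    have "h x \<in> V x" if "x \<in> topspace X" for x
      using eq[of x] V(2) that by (cases "V x = UNIV") (auto simp: PiE_iff)
    then have "h \<in> Pi\<^sub>E (topspace X) V"
      using h by (simp add: topspace_Cp PiE_iff)
    then show "h \<in> U"
      using h V(3) U by (auto simp: topspace_Cp)
  qed auto
qed

text \<open>Outside of a finite set, complete regularity allows the value at one point to be changed
  arbitrarily, by adding a multiple of a bump function.\<close>

lemma Cp_prescribe_value:
  assumes "completely_regular_space X" "t1_space X"
    and F: "finite F" "F \<subseteq> topspace X" and y: "y \<in> topspace X" "y \<notin> F"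
    and g: "g \<in> topspace (Cp X)"
  obtains f where "f \<in> topspace (Cp X)" "f y = c" "\<And>x. x \<in> F \<Longrightarrow> f x = g x"
proof -
  have "closedin X F"
    using assms(2) F by (simp add: t1_space_closedin_finite)
  then obtain h :: "'a \<Rightarrow> real" where h: "continuous_map X (top_of_set {0..1}) h" "h y = 0" "h ` F \<subseteq> {1}"
    using assms(1) y unfolding completely_regular_space_def by (metis DiffI)
  then have cont_h: "continuous_map X euclideanreal h"
    by (simp add: continuous_map_in_subtopology)
  have cont_g: "continuous_map X euclideanreal g"
    using g by (simp add: topspace_Cp)
  define f where "f = (\<lambda>x\<in>topspace X. g x + (c - g y) * (1 - h x))"
  have "continuous_map X euclideanreal (\<lambda>x. g x + (c - g y) * (1 - h x))"
    using cont_g cont_h by (intro continuous_intros)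
  then have "continuous_map X euclideanreal f"
    by (rule continuous_map_eq) (simp add: f_def)
  then have "f \<in> topspace (Cp X)"
    by (simp add: topspace_Cp f_def)
  moreover have "f y = c"
    using y h by (simp add: f_def)
  moreover have "f x = g x" if "x \<in> F" for x
    using that F h(3) by (auto simp: f_def)
  ultimately show thesis
    by (rule that)
qed

text \<open>Each \<open>U n\<close> contains a nonempty basic open set. Together these restrict the values at countably
  many points only, and \<open>y\<close> is any other point.\<close>

lemma Cp_pick_unbounded:
  fixes U :: "nat \<Rightarrow> ('a \<Rightarrow> real) set"
  assumes "completely_regular_space X" "t1_space X" "uncountable (topspace X)"
    and U: "\<And>n. openin (Cp X) (U n)" "\<And>n. U n \<noteq> {}"
  obtains y f where "y \<in> topspace X" "\<forall>n. f n \<in> U n" "\<forall>n. f n y = real n + 1"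
proof -
  have "\<exists>g F. g \<in> U n \<and> finite F \<and> F \<subseteq> topspace X \<and>
          (\<forall>h\<in>topspace (Cp X). (\<forall>x\<in>F. h x = g x) \<longrightarrow> h \<in> U n)" for n
  proof -
    obtain g where "g \<in> U n"
      using U(2) by blast
    then show ?thesis
      using Cp_open_finite_support[OF U(1)] by metis
  qed
  then obtain g F where gF: "\<And>n. g n \<in> U n" "\<And>n. finite (F n)" "\<And>n. F n \<subseteq> topspace X"
    "\<And>n h. h \<in> topspace (Cp X) \<Longrightarrow> (\<forall>x\<in>F n. h x = g n x) \<Longrightarrow> h \<in> U n"
    by metis
  have "countable (\<Union>n. F n)"
    using gF(2) by (simp add: countable_finite)
  then obtain y where y: "y \<in> topspace X" "\<And>n. y \<notin> F n"
    using assms(3) by (metis UN_I UNIV_I countable_subset subsetI)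
  have "\<exists>f. f \<in> U n \<and> f y = real n + 1" for n
  proof -
    have "g n \<in> topspace (Cp X)"
      using gF(1) U(1) openin_subset by blast
    then obtain f where "f \<in> topspace (Cp X)" "f y = real n + 1" "\<And>x. x \<in> F n \<Longrightarrow> f x = g n x"
      using Cp_prescribe_value[OF assms(1,2) gF(2,3) y(1) y(2)] by metis
    then show ?thesis
      using gF(4) by blast
  qed
  then show thesis
    using that[OF y(1)] by metis
qed

lemma countable_if_CL_Cp:
  assumes "completely_regular_space X" "t1_space X"
    and "I_has_winning_predetermined (CL (Cp X) (Cp_zero X))"
  shows "countable (topspace X)"
proof (rule ccontr)
  assume unc: "uncountable (topspace X)"
  obtain U where "predetermined_winning_I (CL (Cp X) (Cp_zero X)) U"
    using assms(3) by (auto simp: I_has_winning_predetermined_def)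
  then have U: "\<And>n. openin (Cp X) (U n)" "\<And>n. U n \<noteq> {}"
    and win: "\<And>f. \<forall>n. f n \<in> U n \<Longrightarrow> Cp_zero X \<in> Cp X closure_of range f"
    by (simp_all add: predetermined_winning_I_def CL_def)
  obtain y f where y: "y \<in> topspace X" and f: "\<forall>n. f n \<in> U n" "\<forall>n. f n y = real n + 1"
    by (rule Cp_pick_unbounded[of X U, OF assms(1,2) unc U])
  define N where "N = {h \<in> topspace (Cp X). h y \<in> {..<1}}"
  have "openin (Cp X) N"
    unfolding N_def using continuous_map_Cp_eval[OF y] by (rule openin_continuous_map_preimage) simp
  moreover have "Cp_zero X \<in> N"
    using y Cp_zero_in_topspace[of X] by (simp add: N_def Cp_zero_def)
  then have "N \<inter> Cp X closure_of range f \<noteq> {}"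
    using win[OF f(1)] by (auto simp: disjoint_iff)
  ultimately have "N \<inter> range f \<noteq> {}"
    by (simp add: openin_Int_closure_of_eq_empty)
  then show False
    using f(2) by (auto simp: N_def)
qed

lemma countable_if_CD_Cp:
  assumes "completely_regular_space X" "t1_space X"
    and "I_has_winning_predetermined (CD (Cp X))"
  shows "countable (topspace X)"
proof (rule ccontr)
  assume unc: "uncountable (topspace X)"
  obtain U where "predetermined_winning_I (CD (Cp X)) U"
    using assms(3) by (auto simp: I_has_winning_predetermined_def)
  then have U: "\<And>n. openin (Cp X) (U n)" "\<And>n. U n \<noteq> {}"
    and win: "\<And>f. \<forall>n. f n \<in> U n \<Longrightarrow> \<not> closed_discrete (Cp X) (range f)"
    by (simp_all add: predetermined_winning_I_def CD_def)
  obtain y f where y: "y \<in> topspace X" and f: "\<forall>n. f n \<in> U n" "\<forall>n. f n y = real n + 1"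
    by (rule Cp_pick_unbounded[of X U, OF assms(1,2) unc U])
  have "range f \<subseteq> topspace (Cp X)"
    using f(1) U(1) openin_subset by blast
  then have "closed_discrete (Cp X) (range f)"
    using closed_discrete_if_unbounded_values[OF t1_space_Cp continuous_map_Cp_eval[OF y]] f(2)
    by blast
  then show False
    using win f(1) by blast
qed

section \<open>Countability of the space characterised by games\<close>

theorem theorem17:
  fixes X :: "'a topology"
  assumes "topspace X \<noteq> {}"
    and "completely_regular_space X"
    and "t1_space X"
  shows
    "(countable (topspace X) \<longleftrightarrow> II_has_winning_Markov (G1 (open_covers X) (open_covers X))) \<and>
     (countable (topspace X) \<longleftrightarrow> II_has_winning_Markov (G1 (omega_covers X) (omega_covers X))) \<and>
     (countable (topspace X) \<longleftrightarrow> I_has_winning_predetermined (PO X)) \<and>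
     (countable (topspace X) \<longleftrightarrow> I_has_winning_predetermined (FO X)) \<and>
     (countable (topspace X) \<longleftrightarrow> I_has_winning_predetermined (OmegaFO X)) \<and>
     (countable (topspace X) \<longleftrightarrow> first_countable (Cp X)) \<and>
     (countable (topspace X) \<longleftrightarrow> I_has_winning_predetermined (Gruenhage_W (Cp X) (Cp_zero X))) \<and>
     (countable (topspace X) \<longleftrightarrow> I_has_winning_predetermined (Gruenhage_clustering (Cp X) (Cp_zero X))) \<and>
     (countable (topspace X) \<longleftrightarrow> I_has_winning_predetermined (CL (Cp X) (Cp_zero X))) \<and>
     (countable (topspace X) \<longleftrightarrow> I_has_winning_predetermined (CD (Cp X))) \<and>
     (countable (topspace X) \<longleftrightarrow> II_has_winning_Markov
        (G1 (clustering_sets (Cp X) (Cp_zero X)) (clustering_sets (Cp X) (Cp_zero X)))) \<and>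
     (countable (topspace X) \<longleftrightarrow> II_has_winning_Markov
        (G1 (dense_sets (Cp X)) (clustering_sets (Cp X) (Cp_zero X))))"
proof -
  let ?Y = "Cp X" and ?z = "Cp_zero X"
  note z = Cp_zero_in_topspace[of X]
  let ?g = "first_countable ?Y"
  let ?h = "I_has_winning_predetermined (Gruenhage_W ?Y ?z)"
  let ?i = "I_has_winning_predetermined (Gruenhage_clustering ?Y ?z)"
  let ?j = "I_has_winning_predetermined (CL ?Y ?z)"
  let ?k = "I_has_winning_predetermined (CD ?Y)"
  let ?l = "II_has_winning_Markov (G1 (clustering_sets ?Y ?z) (clustering_sets ?Y ?z))"
  let ?m = "II_has_winning_Markov (G1 (dense_sets ?Y) (clustering_sets ?Y ?z))"
  have PO: "countable (topspace X) \<longleftrightarrow> I_has_winning_predetermined (PO X)"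
    and FO: "countable (topspace X) \<longleftrightarrow> I_has_winning_predetermined (FO X)"
    and OmegaFO: "countable (topspace X) \<longleftrightarrow> I_has_winning_predetermined (OmegaFO X)"
    using PO_if_countable[OF assms(1)] FO_if_PO[of X] OmegaFO_if_countable[of X]
      FO_if_OmegaFO[of X] countable_if_FO[OF assms(3)] by iprover+
  have ag: "countable (topspace X) \<Longrightarrow> ?g"
    by (rule first_countable_Cp_if_countable)
  have gh: "?g \<Longrightarrow> ?h"
    using z by (rule Gruenhage_W_if_first_countable[rotated])
  have hi: "?h \<Longrightarrow> ?i"
    by (rule Gruenhage_clustering_if_W)
  have ij: "?i \<Longrightarrow> ?j"
    by (rule CL_if_Gruenhage_clustering)
  have ja: "?j \<Longrightarrow> countable (topspace X)"
    by (rule countable_if_CL_Cp[OF assms(2,3)])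
  have hk: "?h \<Longrightarrow> ?k"
    by (rule CD_if_Gruenhage_W[OF _ t1_space_Cp Cp_zero_not_isolated[OF assms(1)]])
  have ka: "?k \<Longrightarrow> countable (topspace X)"
    by (rule countable_if_CD_Cp[OF assms(2,3)])
  have il: "?i \<Longrightarrow> ?l"
    by (rule Markov_clustering_if_Gruenhage_clustering)
  have lm: "?l \<Longrightarrow> ?m"
    using z by (rule Markov_dense_if_Markov_clustering[rotated])
  have mj: "?m \<Longrightarrow> ?j"
    by (rule CL_if_Markov_dense)
  have "countable (topspace X) \<longleftrightarrow> ?g" "countable (topspace X) \<longleftrightarrow> ?h"
    "countable (topspace X) \<longleftrightarrow> ?i" "countable (topspace X) \<longleftrightarrow> ?j"
    "countable (topspace X) \<longleftrightarrow> ?k" "countable (topspace X) \<longleftrightarrow> ?l"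
    "countable (topspace X) \<longleftrightarrow> ?m"
    using ag gh hi ij ja hk ka il lm mj by iprover+
  with PO FO OmegaFO show ?thesis
    unfolding Markov_open_covers_iff_PO Markov_omega_covers_iff_OmegaFO
    by (intro conjI)
qed

end
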